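(* There is a sequence of polynomials $q_0(x),q_1(x),\ldots$ such that for all $k\ge0$, $$B_{2n+1}^{=n+k}=q_k(n)\,(2n)!!\quad\text{for all } n\ge k+1.$$ Moreover $q_0(x)=1$, and for $k\ge1$ the values $q_k(n)$ are given by the recursion $$q_k(n)=\frac{B_{2k+1}(1)}{(2k)!!}+\sum_{j=1}^k\sum_{t=k+2}^n\frac{B_{2j+1}(1)\prod_{s=0}^{j-1}(2t-1-2s)}{(2j+1)!}\,q_{k-j}(t-j-1).$$
   Context: For $\sigma=\sigma_1\ldots\sigma_n\in S_n$, let $\mathrm{mmp}^{(1,0,0,0)}(\sigma)$ be the number of indices $i$ such that there exists $j>i$ with $\sigma_j>\sigma_i$. $UD_n$ is the set of up-down permutations in $S_n$ ($\sigma_1<\sigma_2>\sigma_3<\sigma_4>\cdots$). $B_{2n+1}^{=m}$ denotes the number of $\sigma\in UD_{2n+1}$ with $\mathrm{mmp}^{(1,0,0,0)}(\sigma)=m$. $B_{2j+1}(1)=|UD_{2j+1}|$. $(2n)!!=\prod_{i=1}^n(2i)$ for $n\ge1$ and $0!!=1$. *)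

theory Defs
  imports Complex_Main "HOL-Combinatorics.Permutations" "HOL-Computational_Algebra.Polynomial"
begin

definition UD :: "nat \<Rightarrow> (nat \<Rightarrow> nat) set" where
  "UD n = {\<sigma>. \<sigma> permutes {1..n} \<and>
    (\<forall>i\<in>{1..<n}. if odd i then \<sigma> i < \<sigma> (i + 1) else \<sigma> i > \<sigma> (i + 1))}"

text \<open>The statistic \<open>mmp\<^sup>(1,0,0,0)\<close>: positions of a permutation of \<open>{1..n}\<close>
  with a larger entry somewhere to the right.\<close>

definition mmp1000 :: "nat \<Rightarrow> (nat \<Rightarrow> nat) \<Rightarrow> nat" where
  "mmp1000 n \<sigma> = card {i \<in> {1..n}. \<exists>j\<in>{1..n}. j > i \<and> \<sigma> j > \<sigma> i}"

text \<open>\<open>Beq n m\<close> is \<open>B\<close> with lower index \<open>2n+1\<close> and upper index \<open>=m\<close>;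
  \<open>Bone j\<close> is the value at \<open>1\<close> of \<open>B\<close> with lower index \<open>2j+1\<close>.\<close>

definition Beq :: "nat \<Rightarrow> nat \<Rightarrow> nat" where
  "Beq n m = card {\<sigma> \<in> UD (2 * n + 1). mmp1000 (2 * n + 1) \<sigma> = m}"

definition Bone :: "nat \<Rightarrow> nat" where
  "Bone j = card (UD (2 * j + 1))"

text \<open>\<open>even_dfact n\<close> is \<open>(2n)!!\<close>, so the argument is half the usual one.\<close>

definition even_dfact :: "nat \<Rightarrow> nat" where
  "even_dfact n = (\<Prod>i=1..n. 2 * i)"

end

theory Submission
  imports Defs "HOL-Combinatorics.Multiset_Permutations" "HOL-Library.Infinite_Set"
begin

text \<open>
  In an up-down permutation of length \<open>2n + 1\<close>, \<open>n \<ge> 1\<close>, the maximum sits at an even position \<open>2j + 2\<close>.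
  The \<open>2j + 1\<close> entries to its left all count towards the statistic, the maximum does not, and the
  entries to its right form an up-down arrangement of length \<open>2(n - 1 - j) + 1\<close> whose statistic is
  unaffected. Writing \<open>A n k\<close> for the number of up-down permutations of length \<open>2n + 1\<close> with statistic
  \<open>n + k\<close>, this gives \<open>A n k = (\<Sum>j. (2n choose (2j + 1)) * Bone j * A (n - 1 - j) (k - j))\<close>.
  After division by \<open>(2n)!!\<close> the term \<open>j = 0\<close> has coefficient 1, so the recurrence expresses the first
  difference in \<open>n\<close> through the quotients for smaller \<open>k\<close>; polynomiality follows because every
  polynomial is the first difference of a polynomial.
\<close>

section \<open>Up-down permutations as alternating lists\<close>

fun alternating :: "bool \<Rightarrow> nat list \<Rightarrow> bool" where
  "alternating up (x # y # zs) \<longleftrightarrow> (if up then x < y else y < x) \<and> alternating (\<not> up) (y # zs)"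
| "alternating up _ \<longleftrightarrow> True"

fun non_rl_maxima :: "nat list \<Rightarrow> nat" where
  "non_rl_maxima [] = 0"
| "non_rl_maxima (x # xs) = (if \<exists>y\<in>set xs. x < y then 1 else 0) + non_rl_maxima xs"

text \<open>The ground set \<open>S\<close> is arbitrary so that the two pieces around a maximum are
  covered as well. The set \<open>A\<close> of allowed statistics serves both counts:
  \<open>UNIV\<close> for \<open>Bone\<close>, a singleton for \<open>Beq\<close>.\<close>

definition updown_lists :: "nat set \<Rightarrow> nat set \<Rightarrow> nat list set" where
  "updown_lists S A =
    {xs \<in> permutations_of_set S. alternating True xs \<and> non_rl_maxima xs \<in> A}"

lemma finite_updown_lists [simp]: "finite (updown_lists S A)"
  unfolding updown_lists_def by simp

lemma alternating_nth:
  "alternating up xs \<longleftrightarrow>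
    (\<forall>i. Suc i < length xs \<longrightarrow> (if even i = up then xs ! i < xs ! Suc i else xs ! Suc i < xs ! i))"
proof (induction up xs rule: alternating.induct)
  case (1 up x y zs)
  have "(\<forall>i. Suc i < length (x # y # zs) \<longrightarrow>
      (if even i = up then (x # y # zs) ! i < (x # y # zs) ! Suc i
       else (x # y # zs) ! Suc i < (x # y # zs) ! i)) \<longleftrightarrow>
    (if up then x < y else y < x) \<and>
    (\<forall>i. Suc i < length (y # zs) \<longrightarrow>
      (if even i = (\<not> up) then (y # zs) ! i < (y # zs) ! Suc i else (y # zs) ! Suc i < (y # zs) ! i))"
    (is "(\<forall>i. ?P i) \<longleftrightarrow> ?A \<and> (\<forall>i. ?Q i)")
  proof -
    have "?P 0 \<longleftrightarrow> ?A" by simp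
    moreover have "?P (Suc i) \<longleftrightarrow> ?Q i" for i by (cases up) simp_all
    moreover have "(\<forall>i. P i) \<longleftrightarrow> P 0 \<and> (\<forall>i. P (Suc i))" for P :: "nat \<Rightarrow> bool"
      by (metis not0_implies_Suc)
    from this[of ?P] have "(\<forall>i. ?P i) \<longleftrightarrow> ?P 0 \<and> (\<forall>i. ?P (Suc i))" .
    ultimately show ?thesis by blast
  qed
  with 1 show ?case by simp
qed auto

lemma non_rl_maxima_card:
  "non_rl_maxima xs = card {i. i < length xs \<and> (\<exists>j<length xs. i < j \<and> xs ! i < xs ! j)}"
proof (induction xs)
  case (Cons x xs)
  let ?I = "\<lambda>xs. {i. i < length xs \<and> (\<exists>j<length xs. i < j \<and> xs ! i < xs ! j)}"
  let ?Z = "if \<exists>y\<in>set xs. x < y then {0::nat} else {}"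
  have ex0: "(\<exists>y\<in>set xs. x < y) \<longleftrightarrow> (\<exists>j<length (x # xs). 0 < j \<and> (x # xs) ! 0 < (x # xs) ! j)"
    by (force simp: in_set_conv_nth Ex_less_Suc2)
  have "?I (x # xs) = ?Z \<union> Suc ` ?I xs"
  proof (rule set_eqI)
    fix i show "i \<in> ?I (x # xs) \<longleftrightarrow> i \<in> ?Z \<union> Suc ` ?I xs"
    proof (cases i)
      case 0 then show ?thesis using ex0 by auto
    next
      case (Suc i') then show ?thesis by (auto simp: Ex_less_Suc2)
    qed
  qed
  moreover have "card (?Z \<union> Suc ` ?I xs) = card ?Z + card (?I xs)"
    by (subst card_Un_disjoint) (auto simp: card_image)
  ultimately show ?case using Cons by simp
qed simp

text \<open>One-line notation, in which deleting the maximum becomes splitting an append. Lists are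
  indexed from 0 and permutations from 1, so ascents at odd positions become ascents at even
  indices.\<close>

lemma UD_list_bij:
  "bij_betw (\<lambda>\<sigma>. map \<sigma> [1..<Suc N]) {\<sigma> \<in> UD N. mmp1000 N \<sigma> \<in> A} (updown_lists {1..N} A)"
proof -
  let ?f = "\<lambda>\<sigma>::nat \<Rightarrow> nat. map \<sigma> [1..<Suc N]"
  have bij: "bij_betw ?f {\<sigma>. \<sigma> permutes {1..N}} (permutations_of_set {1..N})"
  proof (rule bij_betw_imageI)
    show "inj_on ?f {\<sigma>. \<sigma> permutes {1..N}}"
    proof (rule inj_onI, rule ext)
      fix \<sigma> \<tau> x assume "\<sigma> \<in> {\<sigma>. \<sigma> permutes {1..N}}" "\<tau> \<in> {\<sigma>. \<sigma> permutes {1..N}}" "?f \<sigma> = ?f \<tau>"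
      then show "\<sigma> x = \<tau> x"
        by (cases "x \<in> {1..N}") (auto simp: permutes_not_in simp del: upt_Suc)
    qed
    show "?f ` {\<sigma>. \<sigma> permutes {1..N}} = permutations_of_set {1..N}"
    proof (intro equalityI subsetI)
      fix xs assume "xs \<in> ?f ` {\<sigma>. \<sigma> permutes {1..N}}"
      then obtain \<sigma> where s: "\<sigma> permutes {1..N}" and xs: "xs = ?f \<sigma>" by blast
      have "set xs = \<sigma> ` {1..N}" unfolding xs by auto
      then have "set xs = {1..N}" using permutes_image[OF s] by simp
      moreover have "distinct xs" unfolding xs distinct_map
        using permutes_inj_on[OF s] by auto
      ultimately show "xs \<in> permutations_of_set {1..N}" by (rule permutations_of_setI)
    next
      fix xs assume "xs \<in> permutations_of_set {1..N}"
      then have st: "set xs = {1..N}" and di: "distinct xs" by (auto simp: permutations_of_set_def)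
      then have len: "length xs = N" using distinct_card[OF di] by simp
      \<comment> \<open>The preimage of \<open>xs\<close>: it reads off the list with the index
        shifted by one and is the identity outside \<open>{1..N}\<close>, as \<open>permutes\<close>
        demands.\<close>
      define \<sigma> where "\<sigma> i = (if i \<in> {1..N} then xs ! (i - 1) else i)" for i
      have "bij_betw \<sigma> {1..N} {1..N}"
      proof (rule bij_betw_imageI)
        show "inj_on \<sigma> {1..N}" using di len
          by (auto simp: inj_on_def \<sigma>_def nth_eq_iff_index_eq)
        then have "card (\<sigma> ` {1..N}) = card {1..N}" by (rule card_image)
        moreover have "\<sigma> ` {1..N} \<subseteq> {1..N}"
        proof
          fix y assume "y \<in> \<sigma> ` {1..N}"
          then obtain i where "i \<in> {1..N}" "y = xs ! (i - 1)" by (auto simp: \<sigma>_def)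
          then show "y \<in> {1..N}" using st len nth_mem[of "i - 1" xs] by auto
        qed
        ultimately show "\<sigma> ` {1..N} = {1..N}" by (simp add: card_subset_eq)
      qed
      then have "\<sigma> permutes {1..N}" by (rule bij_imp_permutes) (auto simp: \<sigma>_def)
      moreover have "xs = ?f \<sigma>" using len by (intro nth_equalityI) (simp_all add: \<sigma>_def del: upt_Suc)
      ultimately show "xs \<in> ?f ` {\<sigma>. \<sigma> permutes {1..N}}" by blast
    qed
  qed
  have alt: "alternating True (?f \<sigma>) \<longleftrightarrow>
      (\<forall>i\<in>{1..<N}. if odd i then \<sigma> i < \<sigma> (i + 1) else \<sigma> i > \<sigma> (i + 1))" for \<sigma>
  proof -
    have "alternating True (?f \<sigma>) \<longleftrightarrow>
        (\<forall>i<N - 1. if odd (Suc i) then \<sigma> (Suc i) < \<sigma> (Suc (Suc i)) else \<sigma> (Suc (Suc i)) < \<sigma> (Suc i))"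
      by (simp add: alternating_nth less_diff_conv del: upt_Suc)
    also have "\<dots> \<longleftrightarrow> (\<forall>i\<in>Suc ` {..<N - 1}. if odd i then \<sigma> i < \<sigma> (i + 1) else \<sigma> i > \<sigma> (i + 1))"
      by auto
    also have "Suc ` {..<N - 1} = {1..<N}"
      by (cases N) (auto simp: lessThan_atLeast0 image_Suc_atLeastLessThan)
    finally show ?thesis .
  qed
  have stat: "non_rl_maxima (?f \<sigma>) = mmp1000 N \<sigma>" for \<sigma>
  proof -
    have "{i \<in> {1..N}. \<exists>j\<in>{1..N}. j > i \<and> \<sigma> j > \<sigma> i} =
      Suc ` {i. i < N \<and> (\<exists>j<N. i < j \<and> \<sigma> (Suc i) < \<sigma> (Suc j))}"
    proof -
      have "{1..N} = Suc ` {..<N}" by (simp add: lessThan_atLeast0 image_Suc_atLeastLessThan atLeastLessThanSuc_atLeastAtMost)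
      then show ?thesis by auto
    qed
    then have "mmp1000 N \<sigma> = card {i. i < N \<and> (\<exists>j<N. i < j \<and> \<sigma> (Suc i) < \<sigma> (Suc j))}"
      unfolding mmp1000_def by (simp add: card_image)
    also have "\<dots> = non_rl_maxima (?f \<sigma>)"
      unfolding non_rl_maxima_card by (rule arg_cong[where f = card]) (auto simp del: upt_Suc)
    finally show ?thesis by simp
  qed
  show ?thesis
    unfolding bij_betw_def
  proof
    show "inj_on ?f {\<sigma> \<in> UD N. mmp1000 N \<sigma> \<in> A}"
      by (rule inj_on_subset[OF bij_betw_imp_inj_on[OF bij]]) (auto simp: UD_def)
    have "{\<sigma> \<in> UD N. mmp1000 N \<sigma> \<in> A} =
        {\<sigma> \<in> {\<sigma>. \<sigma> permutes {1..N}}. alternating True (?f \<sigma>) \<and> non_rl_maxima (?f \<sigma>) \<in> A}"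
      unfolding UD_def alt stat by blast
    moreover have "?f ` \<dots> = {xs \<in> ?f ` {\<sigma>. \<sigma> permutes {1..N}}. alternating True xs \<and> non_rl_maxima xs \<in> A}"
      by blast
    ultimately show "?f ` {\<sigma> \<in> UD N. mmp1000 N \<sigma> \<in> A} = updown_lists {1..N} A"
      unfolding bij_betw_imp_surj_on[OF bij] updown_lists_def by auto
  qed
qed

section \<open>Invariance under order-preserving relabelling\<close>

lemma alternating_map:
  assumes "strict_mono_on S h" "set xs \<subseteq> S"
  shows "alternating up (map h xs) \<longleftrightarrow> alternating up xs"
  using assms(2)
  by (induction up xs rule: alternating.induct) (auto simp: strict_mono_on_less[OF assms(1)])

lemma non_rl_maxima_map:
  assumes "strict_mono_on S h" "set xs \<subseteq> S"
  shows "non_rl_maxima (map h xs) = non_rl_maxima xs"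
  using assms(2)
proof (induction xs)
  case (Cons x xs)
  then have "(\<exists>y\<in>set xs. h x < h y) \<longleftrightarrow> (\<exists>y\<in>set xs. x < y)"
    by (intro bex_cong refl strict_mono_on_less[OF assms(1)]) auto
  with Cons show ?case by simp
qed simp

lemma card_updown_lists_image:
  assumes mono: "strict_mono_on S h"
  shows "card (updown_lists (h ` S) A) = card (updown_lists S A)"
proof -
  have inj: "inj_on h S" by (rule strict_mono_on_imp_inj_on[OF mono])
  have "map h ` updown_lists S A = updown_lists (h ` S) A"
  proof (intro equalityI subsetI)
    fix ys assume "ys \<in> map h ` updown_lists S A"
    then obtain xs where "xs \<in> updown_lists S A" "ys = map h xs" by blast
    then show "ys \<in> updown_lists (h ` S) A"
      using inj alternating_map[OF mono, of xs True] non_rl_maxima_map[OF mono, of xs]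
      by (auto simp: updown_lists_def permutations_of_set_def distinct_map)
  next
    fix ys assume ys: "ys \<in> updown_lists (h ` S) A"
    then have set_ys: "set ys = h ` S"
      by (simp add: updown_lists_def permutations_of_set_def)
    then have "ys \<in> map h ` lists S" unfolding lists_image[symmetric] by auto
    then obtain xs where xs: "set xs \<subseteq> S" "ys = map h xs" by auto
    then have "set xs = S" using set_ys inj_on_image_eq_iff[OF inj, of "set xs" S] by simp
    then have "xs \<in> updown_lists S A"
      using xs ys inj alternating_map[OF mono, of xs True] non_rl_maxima_map[OF mono, of xs]
      by (auto simp: updown_lists_def permutations_of_set_def distinct_map)
    then show "ys \<in> map h ` updown_lists S A" using xs(2) by blast
  qed
  moreover have "inj_on (map h) (updown_lists S A)"
    using inj by (intro inj_on_subset[OF inj_on_mapI[of h "updown_lists S A"]])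
      (auto simp: updown_lists_def permutations_of_set_def intro: inj_on_subset)
  ultimately show ?thesis using card_image by fastforce
qed

text \<open>Alternation and statistic depend only on comparisons, and both sets are order-isomorphic
  to the same initial segment. This lets the pieces beside the maximum be counted by their sizes
  alone.\<close>

lemma card_updown_lists_cong:
  assumes "finite S" "finite T" "card S = card T"
  shows "card (updown_lists S A) = card (updown_lists T A)"
proof -
  have "card (updown_lists S A) = card (updown_lists {..<card S} A)" if S: "finite S" for S
  proof -
    obtain h where "bij_betw h {..<card S} S" "strict_mono_on {..<card S} h"
      by (rule ex_bij_betw_strict_mono_card[OF S])
    then show ?thesis using card_updown_lists_image by (metis bij_betw_imp_surj_on)
  qed
  from this[OF assms(1)] this[OF assms(2)] assms(3) show ?thesis by simp
qed

lemma card_UD_mmp: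
  "card {\<sigma> \<in> UD N. mmp1000 N \<sigma> \<in> A} = card (updown_lists {1..N} A)"
  by (rule bij_betw_same_card[OF UD_list_bij])

section \<open>Splitting at the maximum\<close>

text \<open>The step into \<open>M\<close> must ascend and the step out of it must descend, which
  fixes the parity of its position; the next step after that ascends, so \<open>zs\<close> starts
  upwards. If \<open>M\<close> stands alone there is no step to constrain.\<close>

lemma alternating_append_max:
  assumes "\<forall>x\<in>set ys \<union> set zs. x < M"
  shows "alternating up (ys @ M # zs) \<longleftrightarrow>
    alternating up ys \<and> alternating True zs \<and> (ys @ zs \<noteq> [] \<longrightarrow> up = odd (length ys))"
  using assms
proof (induction up ys rule: alternating.induct)
  case ("2_1" up)
  then show ?case by (cases zs) auto
next
  case ("2_2" up y)
  then show ?case by (cases zs) auto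
qed auto

text \<open>\<open>M\<close> exceeds everything to its left, is exceeded by nothing, and leaves the
  entries to its right unaffected.\<close>

lemma non_rl_maxima_append_max:
  assumes "\<forall>x\<in>set ys \<union> set zs. x < M"
  shows "non_rl_maxima (ys @ M # zs) = length ys + non_rl_maxima zs"
  using assms by (induction ys) auto

text \<open>Cut the list into consecutive pairs: each pair is an ascent, so its first entry counts.
  For length 2n+1 the statistic is thus at least n.\<close>

lemma half_length_le_non_rl_maxima:
  "alternating up xs \<Longrightarrow> up \<Longrightarrow> length xs div 2 \<le> non_rl_maxima xs"
proof (induction xs rule: induct_list012)
  case (3 x y zs)
  then have "alternating True zs" by (cases zs rule: remdups_adj.cases) auto
  with 3 show ?case by auto
qed auto

text \<open>\<open>T\<close> is the set of entries left of \<open>M\<close> and 2j+1 their number;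
  \<open>T\<close> is kept in the index so that, once it is fixed, the two sides can be chosen
  independently.\<close>

lemma updown_lists_split_max:
  assumes S: "finite S" "card S = 2 * n + 1" and n: "n \<ge> 1" and M: "M = Max S"
  shows "bij_betw (\<lambda>(j, T, ys, zs). ys @ M # zs)
    (SIGMA j:{..<n}. SIGMA T:{T. T \<subseteq> S - {M} \<and> card T = 2 * j + 1}.
       updown_lists T UNIV \<times> updown_lists (S - {M} - T) {s. 2 * j + 1 + s = m})
    (updown_lists S {m})" (is "bij_betw ?f ?D _")
proof (rule bij_betw_imageI)
  have "S \<noteq> {}" using S by auto
  then have MS: "M \<in> S" and less: "\<And>x. x \<in> S - {M} \<Longrightarrow> x < M"
    using S(1) M by (auto simp: less_le)
  have D: "set ys = T \<and> distinct ys \<and> length ys = 2 * j + 1 \<and> T \<subseteq> S - {M} \<and> set zs = S - {M} - T"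
    if "(j, T, ys, zs) \<in> ?D" for j T ys zs
    using that distinct_card[of ys] by (auto simp: updown_lists_def permutations_of_set_def)
  show "inj_on ?f ?D"
  proof (rule inj_onI)
    fix p q assume pq: "p \<in> ?D" "q \<in> ?D" "?f p = ?f q"
    obtain j T ys zs where p: "p = (j, T, ys, zs)" by (cases p)
    obtain j' T' ys' zs' where q: "q = (j', T', ys', zs')" by (cases q)
    note Dp = D[OF pq(1)[unfolded p]] and Dq = D[OF pq(2)[unfolded q]]
    have "ys @ M # zs = ys' @ M # zs'" using pq(3) p q by simp
    \<comment> \<open>Since \<open>M\<close> occurs only once, the cut can be recovered from the
      list; \<open>ys\<close> then determines \<open>T\<close> and \<open>j\<close>.\<close>
    moreover have "M \<notin> set ys" "M \<notin> set zs" using Dp by auto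
    ultimately have "ys = ys'" "zs = zs'" by (simp_all add: append_Cons_eq_iff)
    then show "p = q" using Dp Dq p q by auto
  qed
  show "?f ` ?D = updown_lists S {m}"
  proof (intro equalityI subsetI)
    fix xs assume "xs \<in> ?f ` ?D"
    then obtain j T ys zs where D': "(j, T, ys, zs) \<in> ?D" and xs: "xs = ys @ M # zs" by auto
    note Dp = D[OF D']
    have lt: "\<forall>x\<in>set ys \<union> set zs. x < M" using Dp less by auto
    show "xs \<in> updown_lists S {m}"
      using D' Dp MS unfolding xs
      by (auto simp: updown_lists_def permutations_of_set_def
          alternating_append_max[OF lt] non_rl_maxima_append_max[OF lt])
  next
    fix xs assume xs: "xs \<in> updown_lists S {m}"
    then have set_xs: "set xs = S" and dist: "distinct xs" and alt: "alternating True xs"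
      and stat: "non_rl_maxima xs = m"
      by (auto simp: updown_lists_def permutations_of_set_def)
    obtain ys zs where ys_zs: "xs = ys @ M # zs" using MS set_xs by (meson split_list)
    have sets: "set ys \<subseteq> S - {M}" "set zs = S - {M} - set ys"
      using dist set_xs ys_zs by auto
    then have lt: "\<forall>x\<in>set ys \<union> set zs. x < M" using less by auto
    have len: "length xs = 2 * n + 1" using distinct_card[OF dist] set_xs S by simp
    \<comment> \<open>This is where \<open>n \<ge> 1\<close> enters: with a neighbour present, the
      parity condition forces \<open>ys\<close> to have odd length.\<close>
    then have "ys @ zs \<noteq> []" using ys_zs n by auto
    then have alts: "alternating True ys" "alternating True zs" and "odd (length ys)"
      using alt unfolding ys_zs alternating_append_max[OF lt] by auto
    then obtain j where j: "length ys = 2 * j + 1" by (auto elim: oddE)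
    have "j < n" using j len ys_zs by simp
    moreover have "card (set ys) = 2 * j + 1" using j dist ys_zs by (simp add: distinct_card)
    moreover have "ys \<in> updown_lists (set ys) UNIV"
      using dist alts ys_zs by (simp add: updown_lists_def permutations_of_set_def)
    moreover have "zs \<in> updown_lists (S - {M} - set ys) {s. 2 * j + 1 + s = m}"
      using dist alts ys_zs sets stat j non_rl_maxima_append_max[OF lt]
      by (simp add: updown_lists_def permutations_of_set_def)
    ultimately have "(j, set ys, ys, zs) \<in> ?D" using sets by blast
    then show "xs \<in> ?f ` ?D" using ys_zs by (intro image_eqI[where x = "(j, set ys, ys, zs)"]) simp_all
  qed
qed

section \<open>The recurrence for \<open>Beq\<close>\<close>

lemma Bone_eq_card: "finite S \<Longrightarrow> card S = 2 * j + 1 \<Longrightarrow> Bone j = card (updown_lists S UNIV)"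
  using card_UD_mmp[of "2 * j + 1" UNIV] card_updown_lists_cong[of S "{1..2 * j + 1}" UNIV]
  by (simp add: Bone_def)

lemma Beq_eq_card: "finite S \<Longrightarrow> card S = 2 * n + 1 \<Longrightarrow> Beq n m = card (updown_lists S {m})"
  using card_UD_mmp[of "2 * n + 1" "{m}"] card_updown_lists_cong[of S "{1..2 * n + 1}" "{m}"]
  by (simp add: Beq_def)

text \<open>Choose the 2j+1 entries left of the maximum and arrange them freely. The right side, of
  length 2(n-1-j)+1, must supply the remaining n+k-(2j+1) = (n-1-j)+(k-j).\<close>

lemma Beq_rec:
  assumes "n \<ge> 1"
  shows "Beq n (n + k) =
    (\<Sum>j | j < n \<and> j \<le> k. (2 * n choose (2 * j + 1)) * (Bone j * Beq (n - 1 - j) (n - 1 - j + (k - j))))"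
proof -
  define S where "S = {1..2 * n + 1}"
  define M where "M = Max S"
  have S: "finite S" "card S = 2 * n + 1" by (simp_all add: S_def)
  then have "M \<in> S" unfolding M_def by (intro Max_in) auto
  then have cardM: "card (S - {M}) = 2 * n" using S by simp
  have right: "card (updown_lists (S - {M} - T) {s. 2 * j + 1 + s = n + k}) =
      (if j \<le> k then Beq (n - 1 - j) (n - 1 - j + (k - j)) else 0)"
    if T: "T \<subseteq> S - {M}" "card T = 2 * j + 1" and j: "j < n" for T j
  proof -
    have fin: "finite T" using T S by (meson finite_Diff finite_subset)
    have card: "card (S - {M} - T) = 2 * (n - 1 - j) + 1"
      using card_Diff_subset[OF fin T(1)] T cardM j by simp
    show ?thesis
    proof (cases "j \<le> k")
      case True
      then have "{s. 2 * j + 1 + s = n + k} = {n - 1 - j + (k - j)}" using j by auto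
      then show ?thesis using True Beq_eq_card[OF _ card] S by simp
    next
      case False
      \<comment> \<open>For j > k the required statistic n+k-2j-1 is smaller than n-1-j, the lower
        bound given by half the length.\<close>
      have "xs \<notin> updown_lists (S - {M} - T) {s. 2 * j + 1 + s = n + k}" for xs
      proof
        assume xs: "xs \<in> updown_lists (S - {M} - T) {s. 2 * j + 1 + s = n + k}"
        then have "length xs = 2 * (n - 1 - j) + 1"
          using card distinct_card[of xs] by (auto simp: updown_lists_def permutations_of_set_def)
        then have "n - 1 - j \<le> non_rl_maxima xs"
          using xs half_length_le_non_rl_maxima[of True xs] by (auto simp: updown_lists_def)
        then show False using xs j False by (auto simp: updown_lists_def)
      qed
      then have "updown_lists (S - {M} - T) {s. 2 * j + 1 + s = n + k} = {}" by blast
      then show ?thesis using False by simp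
    qed
  qed
  have "Beq n (n + k) = card (updown_lists S {n + k})" by (rule Beq_eq_card[OF S])
  also have "\<dots> = (\<Sum>j<n. \<Sum>T | T \<subseteq> S - {M} \<and> card T = 2 * j + 1.
      card (updown_lists T UNIV) * card (updown_lists (S - {M} - T) {s. 2 * j + 1 + s = n + k}))"
    using S by (subst bij_betw_same_card[OF updown_lists_split_max[OF S assms M_def], symmetric])
      (simp add: card_cartesian_product)
  also have "\<dots> = (\<Sum>j<n. \<Sum>T | T \<subseteq> S - {M} \<and> card T = 2 * j + 1.
      Bone j * (if j \<le> k then Beq (n - 1 - j) (n - 1 - j + (k - j)) else 0))"
  proof (intro sum.cong refl)
    fix j T assume "j \<in> {..<n}" "T \<in> {T. T \<subseteq> S - {M} \<and> card T = 2 * j + 1}"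
    moreover from this have "finite T" using S by (auto intro: finite_subset)
    ultimately show "card (updown_lists T UNIV) * card (updown_lists (S - {M} - T) {s. 2 * j + 1 + s = n + k})
        = Bone j * (if j \<le> k then Beq (n - 1 - j) (n - 1 - j + (k - j)) else 0)"
      using right[of T j] Bone_eq_card[of T j] by simp
  qed
  also have "\<dots> = (\<Sum>j<n. if j \<le> k
      then (2 * n choose (2 * j + 1)) * (Bone j * Beq (n - 1 - j) (n - 1 - j + (k - j))) else 0)"
    \<comment> \<open>The summand no longer depends on \<open>T\<close>, so the inner sum only
      counts subsets of size 2j+1.\<close>
    using n_subsets[of "S - {M}"] cardM S by (intro sum.cong refl) simp
  also have "\<dots> = (\<Sum>j | j < n \<and> j \<le> k.
      (2 * n choose (2 * j + 1)) * (Bone j * Beq (n - 1 - j) (n - 1 - j + (k - j))))"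
    by (simp add: sum.If_cases Int_def)
  finally show ?thesis .
qed

lemma updown_lists_singleton: "updown_lists {x} A = (if 0 \<in> A then {[x]} else {})"
  by (auto simp: updown_lists_def)

lemma Bone_0: "Bone 0 = 1"
  using Bone_eq_card[of "{0}" 0] by (simp add: updown_lists_singleton)

lemma Beq_0: "Beq 0 k = (if k = 0 then 1 else 0)"
  using Beq_eq_card[of "{0}" 0 k] by (simp add: updown_lists_singleton)

text \<open>For n >= 1 neither the maximum nor the last entry counts, so the statistic is at most
  2n-1. The formal argument is by the recurrence: from j < n <= k follow n-1-j <= k-j and k-j >= 1,
  so every term vanishes by induction.\<close>

lemma Beq_eq_0: "Beq n (n + k) = 0" if "n \<le> k" "k \<ge> 1"
  using that
proof (induction n arbitrary: k rule: less_induct)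
  case (less n)
  show ?case
  proof (cases "n = 0")
    case True
    then show ?thesis using less by (simp add: Beq_0)
  next
    case False
    have "Beq (n - 1 - j) (n - 1 - j + (k - j)) = 0" if "j < n" "j \<le> k" for j
      using that less.prems by (intro less.IH) auto
    then show ?thesis using Beq_rec[of n k] False by simp
  qed
qed

section \<open>Normalization by the double factorial\<close>

text \<open>For n >= k+1 this is the value that q_k has to take at n.\<close>

definition normalized_Beq :: "nat \<Rightarrow> nat \<Rightarrow> real" where
  "normalized_Beq n k = real (Beq n (n + k)) / real (even_dfact n)"

text \<open>What becomes of (2n choose 2j+1) \<open>Bone j\<close> when the recurrence is divided by
  (2n)!!, written in a form that is visibly polynomial in n.\<close>

definition rec_coeff :: "nat \<Rightarrow> nat \<Rightarrow> real" where
  "rec_coeff j n = real (Bone j) * (\<Prod>s=0..<j. 2 * real n - 1 - 2 * real s) / fact (2 * j + 1)"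

lemma even_dfact_Suc: "even_dfact (Suc n) = 2 * Suc n * even_dfact n"
  by (simp add: even_dfact_def)

lemma even_dfact_pos: "even_dfact n > 0"
  by (simp add: even_dfact_def prod_pos)

text \<open>In the falling factorial 2n(2n-1)...(2n-2j) the even factors complete (2(n-1-j))!! to
  (2n)!!, and the odd factors form the remaining product.\<close>

lemma choose_odd_even_dfact:
  assumes "j < n"
  shows "real (2 * n choose (2 * j + 1)) * real (even_dfact (n - 1 - j)) =
    (\<Prod>s=0..<j. 2 * real n - 1 - 2 * real s) / fact (2 * j + 1) * real (even_dfact n)"
proof -
  have "(\<Prod>i<2 * j + 1. 2 * real n - real i) * real (even_dfact (n - 1 - j)) =
    (\<Prod>s=0..<j. 2 * real n - 1 - 2 * real s) * real (even_dfact n)"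
    using assms
  proof (induction j)
    case 0
    then show ?case using even_dfact_Suc[of "n - 1"] by simp
  next
    case (Suc j)
    \<comment> \<open>Raising j by one adds an odd factor 2n-1-2j and an even factor 2n-2(j+1); the
      latter is the leading factor of (2(n-1-j))!!.\<close>
    have e: "real (even_dfact (n - 1 - j)) = (2 * real n - 2 * real (Suc j)) * real (even_dfact (n - 1 - Suc j))"
    proof -
      have "n - 1 - j = Suc (n - 1 - Suc j)" using Suc.prems by simp
      then have "even_dfact (n - 1 - j) = 2 * (n - Suc j) * even_dfact (n - 1 - Suc j)"
        using even_dfact_Suc[of "n - 1 - Suc j"] Suc.prems by simp
      then show ?thesis using Suc.prems by (simp add: of_nat_diff right_diff_distrib)
    qed
    have "(\<Prod>i<2 * Suc j + 1. 2 * real n - real i) * real (even_dfact (n - 1 - Suc j)) =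
      (\<Prod>i<2 * j + 1. 2 * real n - real i) * (2 * real n - 1 - 2 * real j) *
        ((2 * real n - 2 * real (Suc j)) * real (even_dfact (n - 1 - Suc j)))"
      by (simp add: algebra_simps)
    also have "\<dots> = (\<Prod>s=0..<Suc j. 2 * real n - 1 - 2 * real s) * real (even_dfact n)"
      unfolding e[symmetric] using Suc by (simp add: mult_ac)
    finally show ?case .
  qed
  moreover have "real (2 * n choose (2 * j + 1)) = (\<Prod>i<2 * j + 1. 2 * real n - real i) / fact (2 * j + 1)"
    unfolding binomial_gbinomial gbinomial_prod_rev by (simp add: lessThan_atLeast0)
  ultimately show ?thesis by simp
qed

lemma normalized_Beq_rec:
  assumes "n \<ge> k + 1"
  shows "normalized_Beq n k = (\<Sum>j\<le>k. rec_coeff j n * normalized_Beq (n - 1 - j) (k - j))"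
proof -
  have "{j. j < n \<and> j \<le> k} = {..k}" using assms by auto
  then have "real (Beq n (n + k)) = (\<Sum>j\<le>k. real (2 * n choose (2 * j + 1)) *
      (real (Bone j) * real (Beq (n - 1 - j) (n - 1 - j + (k - j)))))"
    using Beq_rec[of n k] assms by simp
  also have "\<dots> = (\<Sum>j\<le>k. rec_coeff j n * normalized_Beq (n - 1 - j) (k - j) * real (even_dfact n))"
  proof (rule sum.cong[OF refl])
    fix j assume "j \<in> {..k}"
    then have j: "j < n" using assms by simp
    have "real (2 * n choose (2 * j + 1)) * (real (Bone j) * real (Beq (n - 1 - j) (n - 1 - j + (k - j)))) =
        real (2 * n choose (2 * j + 1)) * real (even_dfact (n - 1 - j)) *
        (real (Bone j) * normalized_Beq (n - 1 - j) (k - j))"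
      using even_dfact_pos[of "n - 1 - j"] by (simp add: normalized_Beq_def)
    then show "real (2 * n choose (2 * j + 1)) * (real (Bone j) * real (Beq (n - 1 - j) (n - 1 - j + (k - j)))) =
        rec_coeff j n * normalized_Beq (n - 1 - j) (k - j) * real (even_dfact n)"
      unfolding choose_odd_even_dfact[OF j] rec_coeff_def by simp
  qed
  also have "\<dots> = (\<Sum>j\<le>k. rec_coeff j n * normalized_Beq (n - 1 - j) (k - j)) * real (even_dfact n)"
    by (rule sum_distrib_right[symmetric])
  finally show ?thesis
    using even_dfact_pos[of n] unfolding normalized_Beq_def[of n k] by simp
qed

text \<open>At n = k+1 the term j involves \<open>normalized_Beq (k - j) (k - j)\<close>, which is 0
  for j < k and 1 for j = k. Only the last coefficient survives.\<close>

lemma normalized_Beq_base: "normalized_Beq (k + 1) k = real (Bone k) / real (even_dfact k)"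
proof -
  have "normalized_Beq (k + 1) k =
      (\<Sum>j\<le>k. if j = k then rec_coeff k (k + 1) else 0)"
    unfolding normalized_Beq_rec[OF order_refl]
  proof (rule sum.cong[OF refl])
    fix j assume "j \<in> {..k}"
    then show "rec_coeff j (k + 1) * normalized_Beq (k + 1 - 1 - j) (k - j) =
        (if j = k then rec_coeff k (k + 1) else 0)"
      using Beq_eq_0[of "k - j" "k - j"]
      by (auto simp: normalized_Beq_def Beq_0 even_dfact_def)
  qed
  also have "\<dots> = rec_coeff k (k + 1)" by simp
  also have "\<dots> = real (Bone k) * (real (2 * (k + 1)) / real (even_dfact (k + 1)))"
  proof -
    \<comment> \<open>The surviving coefficient is easiest to evaluate by reading
      \<open>choose_odd_even_dfact\<close> backwards, as the binomial is just 2k+2.\<close>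
    have "2 * (k + 1) choose (2 * k + 1) = 2 * (k + 1)"
      using binomial_Suc_n[of "2 * k + 1"] by simp
    moreover have "even_dfact (k + 1 - 1 - k) = 1" by (simp add: even_dfact_def)
    ultimately have "real (2 * (k + 1) choose (2 * k + 1)) * real (even_dfact (k + 1 - 1 - k)) =
        real (2 * (k + 1))"
      by (simp only: of_nat_1 mult_1_right)
    with choose_odd_even_dfact[OF less_add_one]
    have "(\<Prod>s=0..<k. 2 * real (k + 1) - 1 - 2 * real s) / fact (2 * k + 1) *
        real (even_dfact (k + 1)) = real (2 * (k + 1))"
      by (rule trans[OF sym])
    then have "(\<Prod>s=0..<k. 2 * real (k + 1) - 1 - 2 * real s) / fact (2 * k + 1) =
        real (2 * (k + 1)) / real (even_dfact (k + 1))"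
      by (rule eq_divide_imp[rotated]) (use even_dfact_pos[of "k + 1"] in simp)
    then show ?thesis unfolding rec_coeff_def times_divide_eq_right[symmetric] by (rule arg_cong)
  qed
  also have "\<dots> = real (Bone k) / real (even_dfact k)"
  proof -
    have "real (even_dfact (k + 1)) = real (2 * (k + 1)) * real (even_dfact k)"
      by (simp only: even_dfact_Suc of_nat_mult flip: Suc_eq_plus1)
    then show ?thesis by (simp del: of_nat_mult of_nat_add)
  qed
  finally show ?thesis .
qed

lemma normalized_Beq_step:
  assumes "n \<ge> k + 1"
  shows "normalized_Beq (Suc n) k =
    normalized_Beq n k + (\<Sum>j=1..k. rec_coeff j (Suc n) * normalized_Beq (n - j) (k - j))"
proof -
  \<comment> \<open>The term j = 0 has coefficient 1 and is the preceding value in n; splitting it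
    off turns the recurrence into a difference equation.\<close>
  have "{..k} = insert 0 {1..k}" by auto
  then show ?thesis
    using normalized_Beq_rec[of k "Suc n"] assms by (simp add: rec_coeff_def Bone_0)
qed

text \<open>Telescoping of the difference equation from n = k+1, where the sum over t is
  empty.\<close>

lemma normalized_Beq_sum:
  assumes "n \<ge> k + 1"
  shows "normalized_Beq n k = real (Bone k) / real (even_dfact k) +
    (\<Sum>t=k+2..n. \<Sum>j=1..k. rec_coeff j t * normalized_Beq (t - 1 - j) (k - j))"
  using assms
proof (induction n rule: nat_induct_at_least)
  case base
  then show ?case using normalized_Beq_base[of k] by simp
next
  case (Suc n)
  then show ?case using normalized_Beq_step[OF Suc.hyps] by simp
qed

section \<open>Antidifferences and polynomiality\<close>

lemma poly_antidifference:
  fixes p :: "real poly"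
  shows "\<exists>P. \<forall>x. poly P (x + 1) - poly P x = poly p x"
proof -
  have monomial: "\<exists>P::real poly. \<forall>x. poly P (x + 1) - poly P x = x ^ d" for d
  proof (induction d rule: less_induct)
    case (less d)
    then obtain P :: "nat \<Rightarrow> real poly"
      where P: "\<And>k x. k < d \<Longrightarrow> poly (P k) (x + 1) - poly (P k) x = x ^ k" by metis
    \<comment> \<open>By the binomial theorem the difference of x^(d+1) is (d+1) x^d plus lower
      powers; subtracting their antidifferences and dividing by d+1 leaves x^d.\<close>
    define Q where "Q = smult (1 / real (Suc d))
      (monom 1 (Suc d) - (\<Sum>k<d. smult (real (Suc d choose k)) (P k)))"
    have "poly Q (x + 1) - poly Q x = x ^ d" for x
    proof -
      have "(x + 1) ^ Suc d = (\<Sum>k<d. real (Suc d choose k) * x ^ k) + real (Suc d) * x ^ d + x ^ Suc d"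
        unfolding binomial_ring[of x 1 "Suc d"] by (simp flip: lessThan_Suc_atMost)
      moreover have "(\<Sum>k<d. real (Suc d choose k) * x ^ k) =
          (\<Sum>k<d. real (Suc d choose k) * poly (P k) (x + 1)) -
          (\<Sum>k<d. real (Suc d choose k) * poly (P k) x)"
        unfolding sum_subtractf[symmetric] right_diff_distrib[symmetric]
        by (intro sum.cong refl) (simp add: P)
      moreover have "real (Suc d) * (poly Q (x + 1) - poly Q x) =
          ((x + 1) ^ Suc d - (\<Sum>k<d. real (Suc d choose k) * poly (P k) (x + 1))) -
          (x ^ Suc d - (\<Sum>k<d. real (Suc d choose k) * poly (P k) x))"
        unfolding Q_def right_diff_distrib
        by (simp add: poly_monom poly_sum del: of_nat_Suc power_Suc binomial_Suc_Suc)
      ultimately have "real (Suc d) * (poly Q (x + 1) - poly Q x) = real (Suc d) * x ^ d" by linarith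
      then show ?thesis by (simp del: of_nat_Suc)
    qed
    then show ?case by blast
  qed
  then obtain P :: "nat \<Rightarrow> real poly"
    where P: "\<And>d x. poly (P d) (x + 1) - poly (P d) x = x ^ d" by metis
  have "poly (\<Sum>i\<le>degree p. smult (coeff p i) (P i)) (x + 1) -
      poly (\<Sum>i\<le>degree p. smult (coeff p i) (P i)) x = poly p x" for x
    by (simp add: poly_sum poly_altdef[of p] P flip: sum_subtractf right_diff_distrib)
  then show ?thesis by blast
qed

lemma rec_coeff_poly: "\<exists>p. \<forall>n. rec_coeff j n = poly p (real n)"
proof
  show "\<forall>n. rec_coeff j n = poly (smult (real (Bone j) / fact (2 * j + 1))
      (\<Prod>s=0..<j. [:- 1 - 2 * real s, 2:])) (real n)"
    by (simp add: rec_coeff_def poly_prod algebra_simps)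
qed

text \<open>By induction on k the first difference in n agrees with a polynomial, so the values
  agree with an antidifference up to a constant, fixed at n = k+1.\<close>

lemma normalized_Beq_poly: "\<exists>p. \<forall>n\<ge>k + 1. normalized_Beq n k = poly p (real n)"
proof (induction k rule: less_induct)
  case (less k)
  then obtain Q where Q: "\<And>i n. i < k \<Longrightarrow> n \<ge> i + 1 \<Longrightarrow> normalized_Beq n i = poly (Q i) (real n)"
    by metis
  obtain C where C: "\<And>j n. rec_coeff j n = poly (C j) (real n)" using rec_coeff_poly by metis
  \<comment> \<open>The increment from n to n+1 as a polynomial in n: the coefficient is taken at
    n+1 and the smaller case at n-j, hence the two shifts.\<close>
  define r where "r = (\<Sum>j=1..k. pcompose (C j) [:1, 1:] * pcompose (Q (k - j)) [:- real j, 1:])"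
  obtain R where R: "\<And>x. poly R (x + 1) - poly R x = poly r x" using poly_antidifference by metis
  define p where "p = [:normalized_Beq (k + 1) k - poly R (real (k + 1)):] + R"
  have "normalized_Beq n k = poly p (real n)" if "n \<ge> k + 1" for n
    using that
  proof (induction n rule: nat_induct_at_least)
    case base
    show ?case by (simp add: p_def)
  next
    case (Suc n)
    have "(\<Sum>j=1..k. rec_coeff j (Suc n) * normalized_Beq (n - j) (k - j)) = poly r (real n)"
      unfolding r_def poly_sum
    proof (rule sum.cong[OF refl])
      fix j assume "j \<in> {1..k}"
      \<comment> \<open>The shifted argument stays in the range k-j+1 <= n-j of the induction
        hypothesis, and the natural subtraction is exact.\<close>
      then have "k - j < k" "k - j + 1 \<le> n - j" "real (n - j) = real n - real j"
        using Suc.hyps by auto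
      then have "normalized_Beq (n - j) (k - j) = poly (Q (k - j)) (real n - real j)"
        by (metis Q)
      then show "rec_coeff j (Suc n) * normalized_Beq (n - j) (k - j) =
          poly (pcompose (C j) [:1, 1:] * pcompose (Q (k - j)) [:- real j, 1:]) (real n)"
        by (simp add: C poly_pcompose)
    qed
    then show ?case
      using normalized_Beq_step[OF Suc.hyps] Suc.IH R[of "real n"] by (simp add: p_def add.commute)
  qed
  then show ?case by blast
qed

lemma normalized_Beq_0: "n \<ge> 1 \<Longrightarrow> normalized_Beq n 0 = 1"
  using normalized_Beq_sum[of 0 n] by (simp add: Bone_0 even_dfact_def)

section \<open>The polynomials q_k and their recursion\<close>

theorem theorem3p4:
  "\<exists>q :: nat \<Rightarrow> real poly.
     (\<forall>k n. n \<ge> k + 1 \<longrightarrow>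
        real (Beq n (n + k)) = poly (q k) (real n) * real (even_dfact n)) \<and>
     q 0 = 1 \<and>
     (\<forall>k n. k \<ge> 1 \<longrightarrow> n \<ge> k + 1 \<longrightarrow>
        poly (q k) (real n) =
          real (Bone k) / real (even_dfact k) +
          (\<Sum>j=1..k. \<Sum>t=k+2..n.
             real (Bone j) * (\<Prod>s=0..<j. 2 * real t - 1 - 2 * real s) / fact (2 * j + 1)
             * poly (q (k - j)) (real t - real j - 1)))"
proof -
  obtain q' where q': "\<And>k n. n \<ge> k + 1 \<Longrightarrow> normalized_Beq n k = poly (q' k) (real n)"
    using normalized_Beq_poly by metis
  \<comment> \<open>The claim for k = 0 is an equality of polynomials, so \<open>q 0\<close> is set
    to 1 outright; it has the right values at all n >= 1.\<close>
  define q where "q k = (if k = 0 then 1 else q' k)" for k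
  have q: "poly (q k) (real n) = normalized_Beq n k" if "n \<ge> k + 1" for k n
    using that by (cases "k = 0") (simp_all add: q_def q'[of k n, symmetric] normalized_Beq_0)
  show ?thesis
  proof (intro exI[of _ q] conjI allI impI)
    fix k n :: nat assume "n \<ge> k + 1"
    then show "real (Beq n (n + k)) = poly (q k) (real n) * real (even_dfact n)"
      using even_dfact_pos[of n] by (simp add: q normalized_Beq_def)
  next
    show "q 0 = 1" by (simp add: q_def)
  next
    fix k n :: nat assume k: "k \<ge> 1" and n: "n \<ge> k + 1"
    have "rec_coeff j t * normalized_Beq (t - 1 - j) (k - j) =
        rec_coeff j t * poly (q (k - j)) (real t - real j - 1)"
      if "j \<in> {1..k}" "t \<in> {k+2..n}" for j t
    proof -
      \<comment> \<open>From t >= k+2 and j <= k, the subtraction is exact and t-1-j >= (k-j)+1,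
        where \<open>q (k - j)\<close> is known to give the count.\<close>
      have "real t - real j - 1 = real (t - 1 - j)" using that by (simp add: of_nat_diff)
      moreover have "t - 1 - j \<ge> k - j + 1" using that by auto
      ultimately show ?thesis by (simp only: q)
    qed
    then have "normalized_Beq n k = real (Bone k) / real (even_dfact k) +
        (\<Sum>t=k+2..n. \<Sum>j=1..k. rec_coeff j t * poly (q (k - j)) (real t - real j - 1))"
      unfolding normalized_Beq_sum[OF n] by (intro arg_cong2[where f = "(+)"] sum.cong refl)
    then show "poly (q k) (real n) = real (Bone k) / real (even_dfact k) +
          (\<Sum>j=1..k. \<Sum>t=k+2..n.
             real (Bone j) * (\<Prod>s=0..<j. 2 * real t - 1 - 2 * real s) / fact (2 * j + 1)
             * poly (q (k - j)) (real t - real j - 1))"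
      \<comment> \<open>Telescoping put the sum over t outside; the claim has it inside.\<close>
      unfolding q[OF n] rec_coeff_def by (subst sum.swap) simp
  qed
qed

end
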